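(* Let $P_1$ and $P_2$ be finitary, closed properties of set functions and let $(J,\mathcal{B})$ be a set algebra. A function $\psi\colon\mathcal{B}\to\mathbb{R}$ is $(P_1,P_2)$-decomposable if and only if there exists a function $r\colon\mathcal{B}\to\mathbb{R}$ such that for every finite measurable partition $\mathcal{Q}$ of $J$, the quotient $\psi/\mathcal{Q}$ has a $(P_1,P_2)$-decomposition $\psi/\mathcal{Q}=\psi_1^{\mathcal{Q}}+\psi_2^{\mathcal{Q}}$ with $|\psi_1^{\mathcal{Q}}(A)|\le r(A)$ for all $A\in\mathcal{B}_{\mathcal{Q}}$.
   Context: A set algebra $(J,\mathcal{B})$ is a set $J$ with a family $\mathcal{B}$ of subsets of $J$ closed under complements and finite unions; members of $\mathcal{B}$ are called measurable. When $J$ is finite, $\mathcal{B}=2^J$. For a finite partition $\mathcal{Q}=\{Q_1,\dots,Q_q\}$ of $J$ into measurable sets and $\varphi\colon\mathcal{B}\to\mathbb{R}$, the quotient $\varphi/\mathcal{Q}\colon 2^{[q]}\to\mathbb{R}$ is $(\varphi/\mathcal{Q})(X)=\varphi\bigl(\bigcup_{i\in X}Q_i\bigr)$, where $[q]=\{1,\dots,q\}$. Also $\mathcal{B}_{\mathcal{Q}}=\{A\in\mathcal{B}: A=\bigcup_{i\in I}Q_i\text{ for some }I\subseteq[q]\}$; a set $A=\bigcup_{i\in I}Q_i\in\mathcal{B}_{\mathcal{Q}}$ is identified with its index set $I\subseteq[q]$, so a function on $2^{[q]}$ can be evaluated at $A$. Set functions $\varphi_1\colon\mathcal{B}_1\to\mathbb{R}$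 and $\varphi_2\colon\mathcal{B}_2\to\mathbb{R}$ on set algebras $(J_1,\mathcal{B}_1)$, $(J_2,\mathcal{B}_2)$ are isomorphic if there is a bijection $f\colon J_1\to J_2$ such that $f$ and $f^{-1}$ are measurable and $\varphi_2(f(X))=\varphi_1(X)$ for all $X\in\mathcal{B}_1$. A property of set functions is an isomorphism-invariant class of set functions (on arbitrary set algebras). A property $P$ is finitary if a function $\varphi\colon\mathcal{B}\to\mathbb{R}$ is in $P$ if and only if $\varphi/\mathcal{Q}$ is in $P$ for every finite measurable partition $\mathcal{Q}$ of $J$. A finitary property $P$ is closed if for every set algebra $(J,\mathcal{B})$ and every finite measurable partition $\mathcal{Q}$ of $J$, the set $\{f\colon\mathcal{B}\to\mathbb{R}\mid f/\mathcal{Q}\in P\}$ is closed in the product topology on $\prod_{A\in\mathcal{B}}\mathbb{R}$. A set function $\psi$ on a set algebra is $(P_1,P_2)$-decomposable if there exist set functions $\psi_1,\psi_2$ on the same set algebra, with $\psi_1$ having property $P_1$ and $\psi_2$ having property $P_2$, such that $\psi=\psi_1+\psi_2$; such an expression is called a $(P_1,P_2)$-decomposition. *)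

theory Defs
  imports "HOL-Analysis.Analysis"
begin

text \<open>
  A set function on a set algebra \<open>(J, \<B>)\<close> is represented by a total function
  \<open>'a set \<Rightarrow> real\<close> of which only the values on \<open>\<B>\<close> matter.
  By convention the algebra on a finite ground set is the full power set.
\<close>

definition set_algebra :: "'a set \<Rightarrow> 'a set set \<Rightarrow> bool" where
  "set_algebra J \<B> \<longleftrightarrow> algebra J \<B> \<and> (finite J \<longrightarrow> \<B> = Pow J)"

text \<open>
  A finite partition is enumerated as \<open>Q 1, \<dots>, Q q\<close>. Its blocks are nonempty, so that a union of
  blocks determines its index set.
\<close>

definition measurable_partition ::
  "'a set \<Rightarrow> 'a set set \<Rightarrow> nat \<Rightarrow> (nat \<Rightarrow> 'a set) \<Rightarrow> bool" where
  "measurable_partition J \<B> q Q \<longleftrightarrow>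
     (\<forall>i\<in>{1..q}. Q i \<in> \<B> \<and> Q i \<noteq> {}) \<and>
     disjoint_family_on Q {1..q} \<and>
     (\<Union>i\<in>{1..q}. Q i) = J"

text \<open>The quotient is a set function on the set algebra \<open>({1..q}, Pow {1..q})\<close>.\<close>

definition set_quotient :: "('a set \<Rightarrow> real) \<Rightarrow> (nat \<Rightarrow> 'a set) \<Rightarrow> nat set \<Rightarrow> real" where
  "set_quotient \<phi> Q X = \<phi> (\<Union>i\<in>X. Q i)"

definition partition_algebra ::
  "'a set set \<Rightarrow> nat \<Rightarrow> (nat \<Rightarrow> 'a set) \<Rightarrow> 'a set set" where
  "partition_algebra \<B> q Q = {A \<in> \<B>. \<exists>I\<subseteq>{1..q}. A = (\<Union>i\<in>I. Q i)}"

definition set_fun_isomorphic ::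
  "'a set \<Rightarrow> 'a set set \<Rightarrow> ('a set \<Rightarrow> real) \<Rightarrow> 'b set \<Rightarrow> 'b set set \<Rightarrow> ('b set \<Rightarrow> real) \<Rightarrow> bool" where
  "set_fun_isomorphic J1 \<B>1 \<phi>1 J2 \<B>2 \<phi>2 \<longleftrightarrow>
     (\<exists>f. bij_betw f J1 J2 \<and>
          (\<forall>Y\<in>\<B>2. f -` Y \<inter> J1 \<in> \<B>1) \<and>
          (\<forall>X\<in>\<B>1. f ` X \<in> \<B>2) \<and>
          (\<forall>X\<in>\<B>1. \<phi>2 (f ` X) = \<phi>1 X))"

text \<open>
  HOL has no predicates ranging over set algebras on all types at once. A property is therefore
  given on the set algebras with ground set in an arbitrary type \<open>'u\<close>, and is transported along
  isomorphisms to set algebras on other types by \<open>has_property\<close>. The latter is needed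
  for quotients, whose ground set \<open>{1..q}\<close> consists of natural numbers; as the blocks of a
  partition are nonempty, the ground set of every quotient of a set function on a subset of \<open>'u\<close>
  is in bijection with a subset of \<open>'u\<close>.
  For an isomorphism-invariant \<open>P\<close>, \<open>has_property P\<close> agrees with \<open>P\<close> on set algebras in \<open>'u\<close>.
  Invariance under the identity isomorphism also makes \<open>P J \<B> \<phi>\<close> independent of the
  values of \<open>\<phi>\<close> outside \<open>\<B>\<close>.
\<close>

type_synonym 'u set_fun_class = "'u set \<Rightarrow> 'u set set \<Rightarrow> ('u set \<Rightarrow> real) \<Rightarrow> bool"

definition set_fun_property :: "'u set_fun_class \<Rightarrow> bool" where
  "set_fun_property P \<longleftrightarrow>
     (\<forall>J1 \<B>1 \<phi>1 J2 \<B>2 \<phi>2.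
        set_algebra J1 \<B>1 \<longrightarrow> set_algebra J2 \<B>2 \<longrightarrow>
        set_fun_isomorphic J1 \<B>1 \<phi>1 J2 \<B>2 \<phi>2 \<longrightarrow> (P J1 \<B>1 \<phi>1 \<longleftrightarrow> P J2 \<B>2 \<phi>2))"

definition has_property ::
  "'u set_fun_class \<Rightarrow> 'a set \<Rightarrow> 'a set set \<Rightarrow> ('a set \<Rightarrow> real) \<Rightarrow> bool" where
  "has_property P J \<B> \<phi> \<longleftrightarrow>
     (\<exists>J' \<B>' \<phi>'. set_algebra J' \<B>' \<and> set_fun_isomorphic J \<B> \<phi> J' \<B>' \<phi>' \<and> P J' \<B>' \<phi>')"

definition finitary_property :: "'u set_fun_class \<Rightarrow> bool" where
  "finitary_property P \<longleftrightarrow>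
     (\<forall>(J :: 'u set) \<B> \<phi>. set_algebra J \<B> \<longrightarrow>
        (has_property P J \<B> \<phi> \<longleftrightarrow>
         (\<forall>q Q. measurable_partition J \<B> q Q \<longrightarrow>
            has_property P {1..q} (Pow {1..q}) (set_quotient \<phi> Q))))"

text \<open>Points of the product topology are the extensional functions on \<open>\<B>\<close>.\<close>

definition closed_property :: "'u set_fun_class \<Rightarrow> bool" where
  "closed_property P \<longleftrightarrow>
     (\<forall>(J :: 'u set) \<B> q Q. set_algebra J \<B> \<longrightarrow> measurable_partition J \<B> q Q \<longrightarrow>
        closedin (product_topology (\<lambda>A. euclideanreal) \<B>)
          {f \<in> extensional \<B>. has_property P {1..q} (Pow {1..q}) (set_quotient f Q)})"

definition is_decomposition ::
  "'u set_fun_class \<Rightarrow> 'u set_fun_class \<Rightarrow> 'a set \<Rightarrow> 'a set set \<Rightarrow>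
   ('a set \<Rightarrow> real) \<Rightarrow> ('a set \<Rightarrow> real) \<Rightarrow> ('a set \<Rightarrow> real) \<Rightarrow> bool" where
  "is_decomposition P1 P2 J \<B> \<psi> \<psi>1 \<psi>2 \<longleftrightarrow>
     has_property P1 J \<B> \<psi>1 \<and> has_property P2 J \<B> \<psi>2 \<and> (\<forall>A\<in>\<B>. \<psi> A = \<psi>1 A + \<psi>2 A)"

definition decomposable ::
  "'u set_fun_class \<Rightarrow> 'u set_fun_class \<Rightarrow> 'a set \<Rightarrow> 'a set set \<Rightarrow> ('a set \<Rightarrow> real) \<Rightarrow> bool" where
  "decomposable P1 P2 J \<B> \<psi> \<longleftrightarrow> (\<exists>\<psi>1 \<psi>2. is_decomposition P1 P2 J \<B> \<psi> \<psi>1 \<psi>2)"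

end

theory Submission
  imports Defs
begin

text \<open>
  The forward direction passes a decomposition \<open>\<psi> = \<psi>1 + \<psi>2\<close> to quotients and takes
  \<open>r = \<bar>\<psi>1\<bar>\<close>. The converse is a compactness argument. Since both properties are finitary,
  a function \<open>f\<close> is the first summand of a decomposition of \<open>\<psi>\<close> exactly when, for every finite
  measurable partition \<open>Q\<close>, the quotients of \<open>f\<close> and \<open>\<psi> - f\<close> by \<open>Q\<close> have \<open>P1\<close> and \<open>P2\<close>
  respectively. For each \<open>Q\<close> this condition is closed in the product topology
  (\<open>closedin_splitting_functions\<close>), and the bound \<open>r\<close> confines \<open>f\<close> to a product of compact
  intervals, which is compact by Tychonoff. It remains to satisfy finitely many of the conditions
  simultaneously.

  Finitely many partitions have a common refinement \<open>R\<close> (\<open>common_refinement\<close>), and the condition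
  for \<open>R\<close> implies the condition for each partition that it refines, because a quotient by the
  coarser partition is a quotient of the quotient by the finer one
  (\<open>has_property_coarser_quotient\<close>). The condition for the single partition \<open>R\<close> is met by
  spreading the assumed bounded decomposition of \<open>\<psi>/R\<close> back over the algebra, with value \<open>0\<close> on
  the sets that are not unions of blocks of \<open>R\<close>.
\<close>

section \<open>Partitions and their refinements\<close>

lemma measurable_partition_block_of:
  assumes "measurable_partition J \<B> q Q" "x \<in> J"
  obtains i where "i \<in> {1..q}" "x \<in> Q i"
proof -
  have "x \<in> (\<Union>i\<in>{1..q}. Q i)" using assms by (simp add: measurable_partition_def)
  then show ?thesis using that by blast
qed

lemma measurable_partition_block_unique:
  assumes "measurable_partition J \<B> q Q" "i \<in> {1..q}" "j \<in> {1..q}" "x \<in> Q i" "x \<in> Q j"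
  shows "i = j"
proof (rule ccontr)
  assume "i \<noteq> j"
  then have "Q i \<inter> Q j = {}"
    using assms(1-3) by (simp add: measurable_partition_def disjoint_family_on_def)
  then show False using assms(4,5) by blast
qed

lemma measurable_partition_UN_in:
  assumes "set_algebra J \<B>" "measurable_partition J \<B> q Q" "X \<subseteq> {1..q}"
  shows "(\<Union>i\<in>X. Q i) \<in> \<B>"
proof -
  interpret algebra J \<B> using assms(1) by (simp add: set_algebra_def)
  have "finite X" using assms(3) finite_subset by blast
  then show ?thesis
    using assms(2,3) by (intro finite_UN) (auto simp: measurable_partition_def)
qed

lemma measurable_partition_exists:
  assumes "set_algebra J \<B>"
  shows "\<exists>q Q. measurable_partition J \<B> q Q"
proof -
  interpret algebra J \<B> using assms by (simp add: set_algebra_def)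
  \<comment> \<open>Blocks are nonempty, so the empty ground set has only the partition into no blocks.\<close>
  have "measurable_partition J \<B> (if J = {} then 0 else 1) (\<lambda>_. J)"
    by (auto simp: measurable_partition_def disjoint_family_on_def)
  then show ?thesis by blast
qed

text \<open>The blocks are nonempty, so a union of blocks remembers which blocks were used.\<close>

lemma measurable_partition_UN_inject:
  assumes "measurable_partition J \<B> q Q" "X \<subseteq> {1..q}" "Y \<subseteq> {1..q}"
    "(\<Union>i\<in>X. Q i) = (\<Union>i\<in>Y. Q i)"
  shows "X = Y"
proof -
  have sub: "X \<subseteq> Y"
    if XY: "X \<subseteq> {1..q}" "Y \<subseteq> {1..q}" "(\<Union>i\<in>X. Q i) = (\<Union>i\<in>Y. Q i)" for X Y
  proof
    fix i assume i: "i \<in> X"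
    then obtain x where x: "x \<in> Q i"
      using assms(1) XY(1) by (fastforce simp: measurable_partition_def)
    then obtain j where j: "j \<in> Y" "x \<in> Q j" using XY(3) i by blast
    have "i = j"
      using measurable_partition_block_unique[OF assms(1)] XY(1,2) i j x by blast
    then show "i \<in> Y" using j by simp
  qed
  show ?thesis using sub[of X Y] sub[of Y X] assms by blast
qed

definition block_refines :: "nat \<Rightarrow> (nat \<Rightarrow> 'a set) \<Rightarrow> nat \<Rightarrow> (nat \<Rightarrow> 'a set) \<Rightarrow> bool" where
  "block_refines m R q Q \<longleftrightarrow> (\<forall>j\<in>{1..m}. \<exists>i\<in>{1..q}. R j \<subseteq> Q i)"

lemma block_refines_trans:
  "block_refines m R n S \<Longrightarrow> block_refines n S q Q \<Longrightarrow> block_refines m R q Q"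
  unfolding block_refines_def by (meson subset_trans)

text \<open>The nonempty intersections of blocks, in any enumeration, refine both partitions.\<close>

lemma common_refinement_two:
  assumes "set_algebra J \<B>" "measurable_partition J \<B> p P" "measurable_partition J \<B> q Q"
  shows "\<exists>m R. measurable_partition J \<B> m R \<and> block_refines m R p P \<and> block_refines m R q Q"
proof -
  interpret algebra J \<B> using assms(1) by (simp add: set_algebra_def)
  define T where "T = {(i, j). i \<in> {1..p} \<and> j \<in> {1..q} \<and> P i \<inter> Q j \<noteq> {}}"
  have "finite T"
    by (rule finite_subset[of _ "{1..p} \<times> {1..q}"]) (auto simp: T_def)
  then obtain h where h: "bij_betw h {1..card T} T"
    using ex_bij_betw_nat_finite_1 by blast
  define R where "R k = P (fst (h k)) \<inter> Q (snd (h k))" for k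
  have hT: "fst (h k) \<in> {1..p}" "snd (h k) \<in> {1..q}" "R k \<noteq> {}" if "k \<in> {1..card T}" for k
    using bij_betwE[OF h] that by (force simp: T_def R_def)+
  have blocks: "R k \<in> \<B>" if "k \<in> {1..card T}" for k
    using assms(2,3) hT[OF that] by (auto simp: R_def measurable_partition_def)
  have disj: "disjoint_family_on R {1..card T}"
    unfolding disjoint_family_on_def
  proof (intro ballI impI)
    fix k l assume kl: "k \<in> {1..card T}" "l \<in> {1..card T}" "k \<noteq> l"
    then have "h k \<noteq> h l" using h by (meson bij_betw_imp_inj_on inj_on_contraD)
    then have "fst (h k) \<noteq> fst (h l) \<or> snd (h k) \<noteq> snd (h l)" by (simp add: prod_eq_iff)
    then show "R k \<inter> R l = {}"
      using measurable_partition_block_unique[OF assms(2) hT(1)[OF kl(1)] hT(1)[OF kl(2)]]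
        measurable_partition_block_unique[OF assms(3) hT(2)[OF kl(1)] hT(2)[OF kl(2)]]
      by (auto simp: R_def)
  qed
  have "x \<in> (\<Union>k\<in>{1..card T}. R k)" if xJ: "x \<in> J" for x
  proof -
    obtain i where i: "i \<in> {1..p}" "x \<in> P i"
      using measurable_partition_block_of[OF assms(2) xJ] .
    obtain j where j: "j \<in> {1..q}" "x \<in> Q j"
      using measurable_partition_block_of[OF assms(3) xJ] .
    have "(i, j) \<in> T" using i j by (auto simp: T_def)
    then have "(i, j) \<in> h ` {1..card T}" using h by (simp add: bij_betw_imp_surj_on)
    then obtain k where k: "k \<in> {1..card T}" "h k = (i, j)" by force
    then have "x \<in> R k" using i j by (simp add: R_def)
    then show ?thesis using k(1) by blast
  qed
  moreover have "R k \<subseteq> J" if "k \<in> {1..card T}" for k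
    using blocks[OF that] sets_into_space by blast
  ultimately have "(\<Union>k\<in>{1..card T}. R k) = J" by blast
  then have "measurable_partition J \<B> (card T) R"
    using blocks disj hT(3) by (simp add: measurable_partition_def)
  moreover have "block_refines (card T) R p P" "block_refines (card T) R q Q"
    unfolding block_refines_def using hT(1,2) unfolding R_def by blast+
  ultimately show ?thesis by blast
qed

lemma common_refinement:
  assumes "set_algebra J \<B>" "finite F" "\<forall>(q, Q)\<in>F. measurable_partition J \<B> q Q"
  shows "\<exists>m R. measurable_partition J \<B> m R \<and> (\<forall>(q, Q)\<in>F. block_refines m R q Q)"
  using assms(2,3)
proof (induction F)
  case empty
  then show ?case using measurable_partition_exists[OF assms(1)] by simp
next
  case (insert a F)
  obtain q Q where a: "a = (q, Q)" by fastforce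
  obtain n S where S: "measurable_partition J \<B> n S" "\<forall>(q, Q)\<in>F. block_refines n S q Q"
    using insert by auto
  obtain m R where R: "measurable_partition J \<B> m R" "block_refines m R n S" "block_refines m R q Q"
    using common_refinement_two[OF assms(1) S(1)] insert.prems a by (metis case_prodD insertI1)
  then show ?case using S(2) a block_refines_trans by fastforce
qed

section \<open>Properties of quotients\<close>

lemma has_property_cong:
  fixes P :: "'u set_fun_class" and \<phi> :: "'a set \<Rightarrow> real"
  assumes "has_property P J \<B> \<phi>" "\<And>A. A \<in> \<B> \<Longrightarrow> \<phi> A = \<phi>' A"
  shows "has_property P J \<B> \<phi>'"
proof -
  have "set_fun_isomorphic J \<B> \<phi> J' \<B>' \<psi> = set_fun_isomorphic J \<B> \<phi>' J' \<B>' \<psi>"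
    for J' \<B>' and \<psi> :: "'u set \<Rightarrow> real"
    unfolding set_fun_isomorphic_def using assms(2) by (simp cong: ball_cong)
  then show ?thesis using assms(1) by (simp add: has_property_def)
qed

lemma has_property_of_class:
  assumes "set_algebra J \<B>" "P J \<B> \<phi>"
  shows "has_property P J \<B> \<phi>"
proof -
  interpret algebra J \<B> using assms(1) by (simp add: set_algebra_def)
  have "f -` Y \<inter> J = Y" if "f = id" "Y \<in> \<B>" for f :: "'a \<Rightarrow> 'a" and Y
    using that sets_into_space by auto
  then have "set_fun_isomorphic J \<B> \<phi> J \<B> \<phi>"
    unfolding set_fun_isomorphic_def by (intro exI[of _ id]) auto
  then show ?thesis using assms unfolding has_property_def by blast
qed

text \<open>
  A finitary property speaks of ground sets in \<open>'u\<close>, whereas a quotient lives on a set of natural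
  numbers. To take a quotient of an arbitrary set function with the property, the partition is
  carried along the isomorphism to the algebra in \<open>'u\<close> that witnesses the property; the quotient
  by the image partition is the same function.
\<close>

lemma has_property_quotient:
  assumes P: "finitary_property P" and \<phi>: "has_property P J \<B> \<phi>"
    and \<B>: "set_algebra J \<B>" and Q: "measurable_partition J \<B> q Q"
  shows "has_property P {1..q} (Pow {1..q}) (set_quotient \<phi> Q)"
proof -
  obtain J' \<B>' \<phi>' g where alg: "set_algebra J' \<B>'" and P': "P J' \<B>' \<phi>'"
    and g: "bij_betw g J J'" "\<forall>X\<in>\<B>. g ` X \<in> \<B>'" "\<forall>X\<in>\<B>. \<phi>' (g ` X) = \<phi> X"
    using \<phi> unfolding has_property_def set_fun_isomorphic_def by blast
  have QJ: "Q i \<subseteq> J" if "i \<in> {1..q}" for i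
    using Q that by (auto simp: measurable_partition_def)
  have "disjoint_family_on (\<lambda>i. g ` Q i) {1..q}"
    unfolding disjoint_family_on_def
  proof (intro ballI impI)
    fix i j assume ij: "i \<in> {1..q}" "j \<in> {1..q}" "i \<noteq> j"
    have "g ` Q i \<inter> g ` Q j = g ` (Q i \<inter> Q j)"
      using g(1) QJ ij by (metis bij_betw_imp_inj_on inj_on_image_Int)
    also have "Q i \<inter> Q j = {}"
      using Q ij by (auto simp: measurable_partition_def disjoint_family_on_def)
    finally show "g ` Q i \<inter> g ` Q j = {}" by simp
  qed
  moreover have "(\<Union>i\<in>{1..q}. g ` Q i) = J'"
    using g(1) Q by (simp add: measurable_partition_def bij_betw_def flip: image_UN)
  ultimately have "measurable_partition J' \<B>' q (\<lambda>i. g ` Q i)"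
    using Q g(2) by (simp add: measurable_partition_def)
  then have "has_property P {1..q} (Pow {1..q}) (set_quotient \<phi>' (\<lambda>i. g ` Q i))"
    using P has_property_of_class[of J' \<B>' P \<phi>', OF alg P'] alg
    unfolding finitary_property_def by blast
  then show ?thesis
  proof (rule has_property_cong)
    fix X assume "X \<in> Pow {1..q}"
    then have "(\<Union>i\<in>X. Q i) \<in> \<B>" using measurable_partition_UN_in[OF \<B> Q] by simp
    then show "set_quotient \<phi>' (\<lambda>i. g ` Q i) X = set_quotient \<phi> Q X"
      using g(3) by (metis set_quotient_def image_UN)
  qed
qed

lemma set_algebra_Pow: "set_algebra J (Pow J)"
  by (simp add: set_algebra_def algebra_Pow)

text \<open>
  If \<open>R\<close> refines \<open>Q\<close>, then grouping the indices of the blocks of \<open>R\<close> by the block of \<open>Q\<close> that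
  contains them gives a partition \<open>S\<close> of \<open>{1..m}\<close> with \<open>\<phi>/Q = (\<phi>/R)/S\<close>.
\<close>

lemma has_property_coarser_quotient:
  assumes P: "finitary_property P"
    and R: "measurable_partition J \<B> m R" and Q: "measurable_partition J \<B> q Q"
    and ref: "block_refines m R q Q"
    and \<phi>: "has_property P {1..m} (Pow {1..m}) (set_quotient \<phi> R)"
  shows "has_property P {1..q} (Pow {1..q}) (set_quotient \<phi> Q)"
proof -
  define S where "S i = {j \<in> {1..m}. R j \<subseteq> Q i}" for i
  have US: "(\<Union>j\<in>S i. R j) = Q i" if i: "i \<in> {1..q}" for i
  proof
    show "(\<Union>j\<in>S i. R j) \<subseteq> Q i" by (auto simp: S_def)
    show "Q i \<subseteq> (\<Union>j\<in>S i. R j)"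
    proof
      fix x assume x: "x \<in> Q i"
      then have "x \<in> J" using Q i by (auto simp: measurable_partition_def)
      then obtain j where j: "j \<in> {1..m}" "x \<in> R j"
        using measurable_partition_block_of[OF R] by blast
      then obtain i' where i': "i' \<in> {1..q}" "R j \<subseteq> Q i'"
        using ref unfolding block_refines_def by blast
      have "i' = i"
        using measurable_partition_block_unique[OF Q i'(1) i _ x] i'(2) j(2) by blast
      then show "x \<in> (\<Union>j\<in>S i. R j)" using i' j by (auto simp: S_def)
    qed
  qed
  have "S i \<noteq> {}" if "i \<in> {1..q}" for i
  proof -
    have "Q i \<noteq> {}" using Q that by (simp add: measurable_partition_def)
    then show ?thesis using US[OF that] by auto
  qed
  moreover have "disjoint_family_on S {1..q}"
    unfolding disjoint_family_on_def
  proof (intro ballI impI)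
    fix i i' assume i: "i \<in> {1..q}" "i' \<in> {1..q}" "i \<noteq> i'"
    then have "Q i \<inter> Q i' = {}"
      using Q by (auto simp: measurable_partition_def disjoint_family_on_def)
    moreover have "R j \<noteq> {}" if "j \<in> {1..m}" for j
      using R that by (simp add: measurable_partition_def)
    ultimately show "S i \<inter> S i' = {}" unfolding S_def by blast
  qed
  moreover have "(\<Union>i\<in>{1..q}. S i) = {1..m}"
    using ref by (auto simp: S_def block_refines_def)
  ultimately have "measurable_partition {1..m} (Pow {1..m}) q S"
    by (auto simp: measurable_partition_def S_def)
  then have "has_property P {1..q} (Pow {1..q}) (set_quotient (set_quotient \<phi> R) S)"
    using has_property_quotient[OF P \<phi> set_algebra_Pow] by blast
  then show ?thesis
  proof (rule has_property_cong)
    fix X assume X: "X \<in> Pow {1..q}"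
    have "(\<Union>j\<in>(\<Union>i\<in>X. S i). R j) = (\<Union>i\<in>X. \<Union>j\<in>S i. R j)" by blast
    also have "\<dots> = (\<Union>i\<in>X. Q i)"
      using US X by (intro SUP_cong refl) (meson Pow_iff subsetD)
    finally show "set_quotient (set_quotient \<phi> R) S X = set_quotient \<phi> Q X"
      by (simp add: set_quotient_def)
  qed
qed

section \<open>First summands of decompositions of a quotient\<close>

definition splitting_functions ::
  "'u set_fun_class \<Rightarrow> 'u set_fun_class \<Rightarrow> 'u set set \<Rightarrow> ('u set \<Rightarrow> real) \<Rightarrow>
   nat \<Rightarrow> (nat \<Rightarrow> 'u set) \<Rightarrow> ('u set \<Rightarrow> real) set" where
  "splitting_functions P1 P2 \<B> \<psi> q Q =
     {f \<in> extensional \<B>.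
        has_property P1 {1..q} (Pow {1..q}) (set_quotient f Q) \<and>
        has_property P2 {1..q} (Pow {1..q}) (set_quotient (\<lambda>A. \<psi> A - f A) Q)}"

text \<open>
  The condition on the second summand cuts out the preimage of a closed set under the continuous
  reflection \<open>f \<mapsto> \<psi> - f\<close>.
\<close>

lemma closedin_splitting_functions:
  assumes P1: "closed_property P1" and P2: "closed_property P2"
    and \<B>: "set_algebra J \<B>" and Q: "measurable_partition J \<B> q Q"
  shows "closedin (product_topology (\<lambda>A. euclideanreal) \<B>) (splitting_functions P1 P2 \<B> \<psi> q Q)"
proof -
  define X where "X = product_topology (\<lambda>A :: 'a set. euclideanreal) \<B>"
  define C where
    "C P = {f \<in> extensional \<B>. has_property P {1..q} (Pow {1..q}) (set_quotient f Q)}"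
    for P :: "'a set_fun_class"
  define refl where "refl f = restrict (\<lambda>A. \<psi> A - f A) \<B>" for f
  have closed: "closedin X (C P1)" "closedin X (C P2)"
    using P1 P2 \<B> Q unfolding closed_property_def X_def C_def by blast+
  have "continuous_map X X refl"
    unfolding X_def refl_def
    by (subst continuous_map_componentwise)
       (auto intro!: continuous_map_diff continuous_map_product_projection)
  then have pre: "closedin X {f \<in> topspace X. refl f \<in> C P2}"
    using closed(2) by (rule closedin_continuous_map_preimage)
  have quot: "set_quotient (refl f) Q Y = set_quotient (\<lambda>A. \<psi> A - f A) Q Y"
    if "Y \<in> Pow {1..q}" for f Y
    using measurable_partition_UN_in[OF \<B> Q] that by (simp add: set_quotient_def refl_def)
  have "refl f \<in> C P2 \<longleftrightarrow>
      has_property P2 {1..q} (Pow {1..q}) (set_quotient (\<lambda>A. \<psi> A - f A) Q)" for f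
  proof -
    have "refl f \<in> extensional \<B>" by (simp add: refl_def)
    moreover have "has_property P2 {1..q} (Pow {1..q}) (set_quotient (refl f) Q) \<longleftrightarrow>
        has_property P2 {1..q} (Pow {1..q}) (set_quotient (\<lambda>A. \<psi> A - f A) Q)"
      using has_property_cong quot by (metis (no_types, lifting))
    ultimately show ?thesis by (simp add: C_def)
  qed
  moreover have "topspace X = extensional \<B>" by (simp add: X_def PiE_def)
  ultimately have
    "splitting_functions P1 P2 \<B> \<psi> q Q = C P1 \<inter> {f \<in> topspace X. refl f \<in> C P2}"
    by (auto simp: splitting_functions_def C_def)
  then show ?thesis using closedin_Int[OF closed(1) pre] by (simp add: X_def)
qed

text \<open>
  Refinement strengthens the condition. This turns a finite intersection of such sets into a
  superset of a single one.
\<close>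

lemma splitting_functions_mono:
  assumes "finitary_property P1" "finitary_property P2"
    and "measurable_partition J \<B> m R" "measurable_partition J \<B> q Q" "block_refines m R q Q"
  shows "splitting_functions P1 P2 \<B> \<psi> m R \<subseteq> splitting_functions P1 P2 \<B> \<psi> q Q"
  unfolding splitting_functions_def
proof (intro Collect_mono impI, elim conjE, intro conjI)
  fix f
  assume "has_property P1 {1..m} (Pow {1..m}) (set_quotient f R)"
  then show "has_property P1 {1..q} (Pow {1..q}) (set_quotient f Q)"
    by (rule has_property_coarser_quotient[OF assms(1,3-5)])
next
  fix f
  assume "has_property P2 {1..m} (Pow {1..m}) (set_quotient (\<lambda>A. \<psi> A - f A) R)"
  then show "has_property P2 {1..q} (Pow {1..q}) (set_quotient (\<lambda>A. \<psi> A - f A) Q)"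
    by (rule has_property_coarser_quotient[OF assms(2,3-5)])
qed

text \<open>
  A decomposition of a quotient lifts to a function on the whole algebra. The absolute value of
  \<open>r\<close> keeps the interval at a set nonempty when that set is not a union of blocks, where the
  hypothesis says nothing about the sign of \<open>r\<close>.
\<close>

lemma bounded_splitting_function_exists:
  assumes \<B>: "set_algebra J \<B>" and Q: "measurable_partition J \<B> q Q"
    and dec: "is_decomposition P1 P2 {1..q} (Pow {1..q}) (set_quotient \<psi> Q) \<psi>1 \<psi>2"
    and bound: "\<And>I. I \<subseteq> {1..q} \<Longrightarrow> \<bar>\<psi>1 I\<bar> \<le> r (\<Union>i\<in>I. Q i)"
  shows "(\<Pi>\<^sub>E A\<in>\<B>. {-\<bar>r A\<bar>..\<bar>r A\<bar>}) \<inter> splitting_functions P1 P2 \<B> \<psi> q Q \<noteq> {}"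
proof -
  define index where "index A = (THE I. I \<subseteq> {1..q} \<and> A = (\<Union>i\<in>I. Q i))" for A
  have index: "index (\<Union>i\<in>I. Q i) = I" if "I \<subseteq> {1..q}" for I
    unfolding index_def
  proof (rule the_equality)
    fix I' assume "I' \<subseteq> {1..q} \<and> (\<Union>i\<in>I. Q i) = (\<Union>i\<in>I'. Q i)"
    then show "I' = I" using measurable_partition_UN_inject[OF Q that, of I'] by simp
  qed (use that in blast)
  define f where
    "f = restrict (\<lambda>A. if \<exists>I\<subseteq>{1..q}. A = (\<Union>i\<in>I. Q i) then \<psi>1 (index A) else 0) \<B>"
  have f: "f (\<Union>i\<in>I. Q i) = \<psi>1 I" if "I \<subseteq> {1..q}" for I
  proof -
    have "\<exists>I'\<subseteq>{1..q}. (\<Union>i\<in>I. Q i) = (\<Union>i\<in>I'. Q i)" using that by blast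
    then show ?thesis
      using index[OF that] measurable_partition_UN_in[OF \<B> Q that]
      unfolding f_def restrict_def by presburger
  qed
  have "\<bar>f A\<bar> \<le> \<bar>r A\<bar>" if "A \<in> \<B>" for A
  proof (cases "\<exists>I\<subseteq>{1..q}. A = (\<Union>i\<in>I. Q i)")
    case True
    then obtain I where I: "I \<subseteq> {1..q}" "A = (\<Union>i\<in>I. Q i)" by blast
    then show ?thesis using f[of I] bound[of I] by simp
  next
    case False
    then have "f A = 0" using that by (simp only: f_def restrict_apply if_True if_False)
    then show ?thesis by simp
  qed
  then have "f A \<in> {-\<bar>r A\<bar>..\<bar>r A\<bar>}" if "A \<in> \<B>" for A
    using that by (simp only: abs_le_iff atLeastAtMost_iff minus_le_iff)
  moreover have ext: "f \<in> extensional \<B>" by (simp add: f_def)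
  ultimately have "f \<in> (\<Pi>\<^sub>E A\<in>\<B>. {-\<bar>r A\<bar>..\<bar>r A\<bar>})" by (auto simp only: PiE_iff)
  moreover have "has_property P1 {1..q} (Pow {1..q}) (set_quotient f Q)"
  proof (rule has_property_cong)
    show "has_property P1 {1..q} (Pow {1..q}) \<psi>1" using dec by (simp add: is_decomposition_def)
  qed (use f in \<open>simp add: set_quotient_def\<close>)
  moreover have "has_property P2 {1..q} (Pow {1..q}) (set_quotient (\<lambda>A. \<psi> A - f A) Q)"
  proof (rule has_property_cong)
    show "has_property P2 {1..q} (Pow {1..q}) \<psi>2" using dec by (simp add: is_decomposition_def)
  qed (use f dec in \<open>simp add: set_quotient_def is_decomposition_def\<close>)
  ultimately have
    "f \<in> (\<Pi>\<^sub>E A\<in>\<B>. {-\<bar>r A\<bar>..\<bar>r A\<bar>}) \<inter> splitting_functions P1 P2 \<B> \<psi> q Q"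
    using ext by (simp add: splitting_functions_def)
  then show ?thesis by blast
qed

section \<open>Decomposability from bounded decompositions of the quotients\<close>

lemma is_decomposition_quotient:
  assumes "finitary_property P1" "finitary_property P2"
    and \<B>: "set_algebra J \<B>" and Q: "measurable_partition J \<B> q Q"
    and dec: "is_decomposition P1 P2 J \<B> \<psi> \<psi>1 \<psi>2"
  shows "is_decomposition P1 P2 {1..q} (Pow {1..q})
    (set_quotient \<psi> Q) (set_quotient \<psi>1 Q) (set_quotient \<psi>2 Q)"
  unfolding is_decomposition_def
proof (intro conjI ballI)
  show "has_property P1 {1..q} (Pow {1..q}) (set_quotient \<psi>1 Q)"
    using has_property_quotient[OF assms(1) _ \<B> Q] dec by (simp add: is_decomposition_def)
  show "has_property P2 {1..q} (Pow {1..q}) (set_quotient \<psi>2 Q)"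
    using has_property_quotient[OF assms(2) _ \<B> Q] dec by (simp add: is_decomposition_def)
  fix X assume "X \<in> Pow {1..q}"
  then show "set_quotient \<psi> Q X = set_quotient \<psi>1 Q X + set_quotient \<psi>2 Q X"
    using measurable_partition_UN_in[OF \<B> Q] dec
    by (simp add: is_decomposition_def set_quotient_def)
qed

text \<open>
  Tychonoff's theorem in its finite intersection form. Finitely many partitions impose no more
  than their common refinement does, so only the solvability for one partition at a time, within
  the bound \<open>r\<close>, enters.
\<close>

lemma common_splitting_function_exists:
  assumes P1: "finitary_property P1" "closed_property P1"
    and P2: "finitary_property P2" "closed_property P2"
    and \<B>: "set_algebra J \<B>"
    and dec: "\<And>q Q. measurable_partition J \<B> q Q \<Longrightarrow>
      \<exists>\<psi>1 \<psi>2. is_decomposition P1 P2 {1..q} (Pow {1..q}) (set_quotient \<psi> Q) \<psi>1 \<psi>2 \<and>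
        (\<forall>I\<subseteq>{1..q}. \<bar>\<psi>1 I\<bar> \<le> r (\<Union>i\<in>I. Q i))"
  shows "\<exists>f. \<forall>q Q. measurable_partition J \<B> q Q \<longrightarrow> f \<in> splitting_functions P1 P2 \<B> \<psi> q Q"
proof -
  define X where "X = product_topology (\<lambda>A :: 'a set. euclideanreal) \<B>"
  define box where "box = (\<Pi>\<^sub>E A\<in>\<B>. {-\<bar>r A\<bar>..\<bar>r A\<bar>})"
  define parts where "parts = {(q, Q). measurable_partition J \<B> q Q}"
  define K where "K = (\<lambda>(q, Q). splitting_functions P1 P2 \<B> \<psi> q Q)"
  have compact: "compactin X box"
    unfolding X_def box_def by (simp add: compactin_PiE)
  have closed: "\<forall>C\<in>K ` parts. closedin X C"
    using closedin_splitting_functions[OF P1(2) P2(2) \<B>] by (auto simp: K_def X_def parts_def)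
  have fip: "box \<inter> \<Inter>\<F> \<noteq> {}" if \<F>: "finite \<F>" "\<F> \<subseteq> K ` parts" for \<F>
  proof -
    obtain F where F: "finite F" "F \<subseteq> parts" "\<F> = K ` F"
      using finite_subset_image[OF \<F>] by blast
    then have "\<forall>(q, Q)\<in>F. measurable_partition J \<B> q Q" by (auto simp: parts_def)
    then obtain m R where
      R: "measurable_partition J \<B> m R" and ref: "\<forall>(q, Q)\<in>F. block_refines m R q Q"
      using common_refinement[OF \<B> F(1)] by blast
    obtain \<psi>1 \<psi>2 where
      "is_decomposition P1 P2 {1..m} (Pow {1..m}) (set_quotient \<psi> R) \<psi>1 \<psi>2"
      "\<And>I. I \<subseteq> {1..m} \<Longrightarrow> \<bar>\<psi>1 I\<bar> \<le> r (\<Union>i\<in>I. R i)"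
      using dec[OF R] by blast
    then have "box \<inter> splitting_functions P1 P2 \<B> \<psi> m R \<noteq> {}"
      unfolding box_def by (rule bounded_splitting_function_exists[OF \<B> R])
    moreover have "splitting_functions P1 P2 \<B> \<psi> m R \<subseteq> \<Inter>\<F>"
      using splitting_functions_mono[OF P1(1) P2(1) R] ref F(2,3)
      by (fastforce simp: K_def parts_def)
    ultimately show ?thesis by blast
  qed
  have "box \<inter> \<Inter>(K ` parts) \<noteq> {}"
    using compact closed fip unfolding compactin_fip by blast
  then show ?thesis by (auto simp: K_def parts_def)
qed

theorem theorem5p1:
  fixes P1 P2 :: "'u set_fun_class"
    and J :: "'u set" and \<B> :: "'u set set" and \<psi> :: "'u set \<Rightarrow> real"
  assumes "set_fun_property P1" and "finitary_property P1" and "closed_property P1"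
    and "set_fun_property P2" and "finitary_property P2" and "closed_property P2"
    and "set_algebra J \<B>"
  shows "decomposable P1 P2 J \<B> \<psi> \<longleftrightarrow>
    (\<exists>r :: 'u set \<Rightarrow> real. \<forall>q Q. measurable_partition J \<B> q Q \<longrightarrow>
       (\<exists>\<psi>1 \<psi>2. is_decomposition P1 P2 {1..q} (Pow {1..q}) (set_quotient \<psi> Q) \<psi>1 \<psi>2 \<and>
          (\<forall>A \<in> partition_algebra \<B> q Q. \<forall>I \<subseteq> {1..q}.
             A = (\<Union>i\<in>I. Q i) \<longrightarrow> \<bar>\<psi>1 I\<bar> \<le> r A)))"
    (is "_ \<longleftrightarrow> (\<exists>r. ?bounded r)")
proof
  assume "decomposable P1 P2 J \<B> \<psi>"
  then obtain \<psi>1 \<psi>2 where dec: "is_decomposition P1 P2 J \<B> \<psi> \<psi>1 \<psi>2"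
    unfolding decomposable_def by blast
  show "\<exists>r. ?bounded r"
  proof (intro exI[of _ "\<lambda>A. \<bar>\<psi>1 A\<bar>"] allI impI)
    fix q Q assume Q: "measurable_partition J \<B> q Q"
    show "\<exists>\<psi>1' \<psi>2'.
        is_decomposition P1 P2 {1..q} (Pow {1..q}) (set_quotient \<psi> Q) \<psi>1' \<psi>2' \<and>
        (\<forall>A \<in> partition_algebra \<B> q Q. \<forall>I \<subseteq> {1..q}.
           A = (\<Union>i\<in>I. Q i) \<longrightarrow> \<bar>\<psi>1' I\<bar> \<le> \<bar>\<psi>1 A\<bar>)"
      using is_decomposition_quotient[OF assms(2,5,7) Q dec]
      by (intro exI[of _ "set_quotient \<psi>1 Q"] exI[of _ "set_quotient \<psi>2 Q"])
         (simp add: set_quotient_def)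
  qed
next
  assume "\<exists>r. ?bounded r"
  then obtain r where r: "?bounded r" ..
  have "\<exists>\<psi>1 \<psi>2. is_decomposition P1 P2 {1..q} (Pow {1..q}) (set_quotient \<psi> Q) \<psi>1 \<psi>2 \<and>
      (\<forall>I\<subseteq>{1..q}. \<bar>\<psi>1 I\<bar> \<le> r (\<Union>i\<in>I. Q i))"
    if Q: "measurable_partition J \<B> q Q" for q Q
  proof -
    have mem: "(\<Union>i\<in>I. Q i) \<in> partition_algebra \<B> q Q" if "I \<subseteq> {1..q}" for I
      using measurable_partition_UN_in[OF assms(7) Q that] that
      by (auto simp: partition_algebra_def)
    obtain \<psi>1 \<psi>2 where
      dec: "is_decomposition P1 P2 {1..q} (Pow {1..q}) (set_quotient \<psi> Q) \<psi>1 \<psi>2"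
      and bound: "\<forall>A \<in> partition_algebra \<B> q Q. \<forall>I \<subseteq> {1..q}.
         A = (\<Union>i\<in>I. Q i) \<longrightarrow> \<bar>\<psi>1 I\<bar> \<le> r A"
      using r[rule_format, OF Q] by (elim exE conjE)
    have "\<forall>I\<subseteq>{1..q}. \<bar>\<psi>1 I\<bar> \<le> r (\<Union>i\<in>I. Q i)"
      using bound[rule_format, OF mem _ refl] by simp
    with dec show ?thesis by (intro exI conjI)
  qed
  then have "\<exists>f. \<forall>q Q. measurable_partition J \<B> q Q \<longrightarrow>
      f \<in> splitting_functions P1 P2 \<B> \<psi> q Q"
    by (rule common_splitting_function_exists[OF assms(2,3,5,6,7)])
  then obtain f where
    f: "\<And>q Q. measurable_partition J \<B> q Q \<Longrightarrow> f \<in> splitting_functions P1 P2 \<B> \<psi> q Q"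
    by blast
  have "has_property P1 J \<B> f" "has_property P2 J \<B> (\<lambda>A. \<psi> A - f A)"
    using assms(2,5,7) f by (simp_all add: finitary_property_def splitting_functions_def)
  then have "is_decomposition P1 P2 J \<B> \<psi> f (\<lambda>A. \<psi> A - f A)"
    by (simp add: is_decomposition_def)
  then show "decomposable P1 P2 J \<B> \<psi>" unfolding decomposable_def by blast
qed

end
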